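(* For every integer $m\geq 1$, \[\psi_{sq}(P_{m}\circ\overline{K_{2}})=2m+\left\lfloor\frac{1}{2}\left\lceil\frac{2m}{3}\right\rceil\right\rfloor .\]
   Context: All graphs are finite and simple (undirected, no loops, no multiple edges). For a graph $G=(V,E)$ and $v\in V$, $N_G[v]=\{v\}\cup\{u\in V: uv\in E\}$ is the closed neighborhood of $v$. A sub-quorum coloring of $G$ is an onto partial function $f:V\rightarrow\{1,2,\ldots,\ell\}$ such that for every vertex $v\in V$, if $f(v)$ is defined, then at least half of the vertices of $N_G[v]$ at which $f$ is defined have the same color (value of $f$) as $v$. The sub-quorum coloring number $\psi_{sq}(G)$ is the maximum value of $\ell$ over all sub-quorum colorings of $G$. $P_m$ is the path on $m$ vertices. The corona $P_m\circ\overline{K_2}$ (the complete double caterpillar) is the graph on $3m$ vertices obtained from $P_m$ by appending two new leaves to each vertex of $P_m$. *)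

theory Defs
  imports Complex_Main "Graph_Theory.Pair_Digraph"
begin

text \<open>
  A finite simple graph is a \<^locale>\<open>pair_graph\<close>: a finite vertex set with a finite, symmetric,
  irreflexive arc relation, so an edge \<open>uv\<close> is the pair of arcs \<open>(u, v)\<close> and \<open>(v, u)\<close>.
\<close>

definition path_graph :: "nat \<Rightarrow> nat pair_pre_digraph" where
  "path_graph m = \<lparr> pverts = {1..m},
     parcs = {(i, j). i \<in> {1..m} \<and> j \<in> {1..m} \<and> (j = Suc i \<or> i = Suc j)} \<rparr>"

definition edgeless_graph :: "nat \<Rightarrow> nat pair_pre_digraph" where
  "edgeless_graph n = \<lparr> pverts = {1..n}, parcs = {} \<rparr>"

text \<open>
  The corona takes one copy of \<open>G\<close> (vertices \<open>Inl u\<close>) and, for each vertex \<open>u\<close> of \<open>G\<close>, a copy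
  of \<open>H\<close> (vertices \<open>Inr (u, x)\<close>), all of whose vertices are joined to \<open>Inl u\<close>. For an
  edgeless \<open>H\<close> this appends pendant leaves to each vertex of \<open>G\<close>.
\<close>

definition corona ::
    "'a pair_pre_digraph \<Rightarrow> 'b pair_pre_digraph \<Rightarrow> ('a + 'a \<times> 'b) pair_pre_digraph" where
  "corona G H = \<lparr> pverts = pverts G <+> (pverts G \<times> pverts H),
     parcs = {(Inl u, Inl v) |u v. (u, v) \<in> parcs G}
       \<union> {(Inr (u, x), Inr (u, y)) |u x y. u \<in> pverts G \<and> (x, y) \<in> parcs H}
       \<union> {(Inl u, Inr (u, x)) |u x. u \<in> pverts G \<and> x \<in> pverts H}
       \<union> {(Inr (u, x), Inl u) |u x. u \<in> pverts G \<and> x \<in> pverts H} \<rparr>"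

definition closed_nbhd :: "'a pair_pre_digraph \<Rightarrow> 'a \<Rightarrow> 'a set" where
  "closed_nbhd G v = {v} \<union> {u \<in> pverts G. (u, v) \<in> parcs G}"

definition sub_quorum_coloring :: "'a pair_pre_digraph \<Rightarrow> nat \<Rightarrow> ('a \<rightharpoonup> nat) \<Rightarrow> bool" where
  "sub_quorum_coloring G l f \<longleftrightarrow> dom f \<subseteq> pverts G \<and> ran f = {1..l} \<and>
     (\<forall>v \<in> dom f. real (card {u \<in> closed_nbhd G v \<inter> dom f. f u = f v})
                     \<ge> real (card (closed_nbhd G v \<inter> dom f)) / 2)"

definition sub_quorum_coloring_number :: "'a pair_pre_digraph \<Rightarrow> nat" ("\<psi>\<^sub>s\<^sub>q") where
  "sub_quorum_coloring_number G = Max {l. \<exists>f. sub_quorum_coloring G l f}"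

text \<open>
  For finite \<open>G\<close> the maximum ranges over a finite nonempty set, so \<^const>\<open>Max\<close> is meaningful.
\<close>

lemma sub_quorum_coloring_le_card:
  assumes "finite (pverts G)" "sub_quorum_coloring G l f"
  shows "l \<le> card (pverts G)"
proof -
  have dom: "dom f \<subseteq> pverts G" and ran: "ran f = {1..l}"
    using assms(2) by (auto simp: sub_quorum_coloring_def)
  have "{1..l} = (the \<circ> f) ` dom f"
    unfolding ran[symmetric] by (force simp: ran_def dom_def image_iff)
  then have "l \<le> card (dom f)"
    by (metis card_atLeastAtMost card_image_le diff_Suc_1 finite_subset[OF dom assms(1)])
  also have "\<dots> \<le> card (pverts G)"
    using card_mono[OF assms(1) dom] .
  finally show ?thesis .
qed

lemma finite_sub_quorum_coloring_sizes:
  assumes "finite (pverts G)"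
  shows "finite {l. \<exists>f. sub_quorum_coloring G l f}"
  by (rule finite_subset[of _ "{..card (pverts G)}"])
     (use sub_quorum_coloring_le_card[OF assms] in auto)

lemma sub_quorum_coloring_empty: "sub_quorum_coloring G 0 Map.empty"
  by (simp add: sub_quorum_coloring_def)

lemma pair_graph_path_graph: "pair_graph (path_graph m)"
proof
  show "finite (parcs (path_graph m))"
    by (rule finite_subset[of _ "{1..m} \<times> {1..m}"]) (auto simp: path_graph_def)
qed (auto simp: path_graph_def symmetric_def sym_def)

lemma pair_graph_edgeless_graph: "pair_graph (edgeless_graph n)"
  by standard (auto simp: edgeless_graph_def symmetric_def sym_def)

lemma pair_graph_corona:
  assumes "pair_graph G" "pair_graph H"
  shows "pair_graph (corona G H)"
proof -
  interpret G: pair_graph G by fact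
  interpret H: pair_graph H by fact
  have symG: "(u, v) \<in> parcs G \<Longrightarrow> (v, u) \<in> parcs G" for u v
    using G.pair_sym_arcs by (auto simp: symmetric_def sym_def)
  have symH: "(u, v) \<in> parcs H \<Longrightarrow> (v, u) \<in> parcs H" for u v
    using H.pair_sym_arcs by (auto simp: symmetric_def sym_def)
  have sub: "parcs (corona G H) \<subseteq> pverts (corona G H) \<times> pverts (corona G H)"
    by (auto simp: corona_def dest: G.in_arcsD1 G.in_arcsD2 H.in_arcsD1 H.in_arcsD2)
  have fin: "finite (pverts (corona G H))"
    using G.pair_finite_verts H.pair_finite_verts by (simp add: corona_def)
  show ?thesis
  proof
    show "finite (parcs (corona G H))"
      using finite_subset[OF sub] fin by blast
    show "symmetric (with_proj (corona G H))"
      by (auto simp: symmetric_def sym_def corona_def dest: symG symH)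
    show "fst e \<noteq> snd e" if "e \<in> parcs (corona G H)" for e
      using that by (auto simp: corona_def dest: G.no_loops' H.no_loops')
    show "fst e \<in> pverts (corona G H)" "snd e \<in> pverts (corona G H)"
      if "e \<in> parcs (corona G H)" for e
      using that sub by auto
  qed (rule fin)
qed

lemma card_corona_path_edgeless: "card (pverts (corona (path_graph m) (edgeless_graph 2))) = 3 * m"
  by (simp add: corona_def path_graph_def edgeless_graph_def card_Plus card_cartesian_product)

end

theory Submission
  imports Defs
begin

text \<open>
  The right-hand side equals \<open>2m + \<lfloor>(m + 1) / 3\<rfloor>\<close>. It is attained by giving all leaves distinct
  colors and each pair \<open>3k + 1, 3k + 2\<close> of spine vertices a further common color, leaving the
  other spine vertices uncolored.

  Conversely, every color occurs at a leaf colored differently from its spine vertex or at the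
  first spine vertex of that color; likewise at such a leaf or at the last spine vertex of that
  color. Add the two resulting bounds on the number of colors. The quorum condition at a spine
  vertex \<open>v\<close> shows that \<open>v\<close> and its leaves contribute at most 4 to the sum, or 5 if exactly one
  spine neighbor of \<open>v\<close> is colored, so that \<open>v\<close> is an end of a run of at least two colored spine
  vertices. These runs need an uncolored vertex between them, so there are at most
  \<open>\<lfloor>(m + 1) / 3\<rfloor>\<close> of them.
\<close>

section \<open>Neighborhoods and the quorum condition in the caterpillar\<close>

abbreviation caterpillar :: "nat \<Rightarrow> (nat + nat \<times> nat) pair_pre_digraph" where
  "caterpillar m \<equiv> corona (path_graph m) (edgeless_graph 2)"

lemma atLeastAtMost_1_2: "{1..2} = {1, 2 :: nat}"
  by auto

lemma pverts_caterpillar: "pverts (caterpillar m) = Inl ` {1..m} \<union> Inr ` ({1..m} \<times> {1, 2})"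
  using atLeastAtMost_1_2 by (simp add: corona_def path_graph_def edgeless_graph_def Plus_def)

lemma closed_nbhd_spine:
  assumes "v \<in> {1..m}"
  shows "closed_nbhd (caterpillar m) (Inl v) =
    {Inl v, Inl (v - 1), Inl (Suc v), Inr (v, 1), Inr (v, 2)} \<inter> pverts (caterpillar m)"
  using assms
  by (auto simp: closed_nbhd_def pverts_caterpillar corona_def path_graph_def edgeless_graph_def
      atLeastAtMost_1_2)

lemma closed_nbhd_leaf:
  assumes "v \<in> {1..m}" "x \<in> {1, 2}"
  shows "closed_nbhd (caterpillar m) (Inr (v, x)) = {Inr (v, x), Inl v}"
  using assms
  by (auto simp: closed_nbhd_def corona_def path_graph_def edgeless_graph_def)

lemma card_insert_Int_if:
  assumes "finite A" "a \<notin> A"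
  shows "card (insert a A \<inter> B) = of_bool (a \<in> B) + card (A \<inter> B)"
  using assms by (simp add: Int_insert_left)

text \<open>Turns the cardinalities of the quorum condition into sums of truth values.\<close>

lemma card_5_Int:
  assumes "distinct [a, b, c, d, e]"
  shows "card ({a, b, c, d, e} \<inter> B) =
    of_bool (a \<in> B) + of_bool (b \<in> B) + of_bool (c \<in> B) + of_bool (d \<in> B) + of_bool (e \<in> B)"
  using assms by (simp add: card_insert_Int_if)

text \<open>
  No guards for the ends of the path are needed: \<open>f\<close> is undefined at \<open>Inl 0\<close> and \<open>Inl (m + 1)\<close>.
\<close>

lemma quorum_spine_iff:
  assumes "dom f \<subseteq> pverts (caterpillar m)" "v \<in> {1..m}" "f (Inl v) \<noteq> None"
  defines "N \<equiv> closed_nbhd (caterpillar m) (Inl v)"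
  shows "real (card {u \<in> N \<inter> dom f. f u = f (Inl v)}) \<ge> real (card (N \<inter> dom f)) / 2 \<longleftrightarrow>
    (let same = (\<lambda>u. of_bool (f u = f (Inl v))); def = (\<lambda>u. of_bool (f u \<noteq> None)) in
      1 + def (Inl (v - 1)) + def (Inl (Suc v)) + def (Inr (v, 1)) + def (Inr (v, 2))
      \<le> 2 * (1 + same (Inl (v - 1)) + same (Inl (Suc v)) + same (Inr (v, 1)) + same (Inr (v, 2)) :: nat))"
proof -
  let ?M = "{Inl v, Inl (v - 1), Inl (Suc v), Inr (v, 1), Inr (v, 2)}"
  \<comment> \<open>Positivity of \<open>v\<close> matters: with truncated subtraction,
    \<open>v - 1\<close> would equal \<open>v\<close> at 0.\<close>
  have distinct: "distinct [Inl v, Inl (v - 1), Inl (Suc v), Inr (v, 1), Inr (v, 2 :: nat)]"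
    using assms(2) by auto
  have "N \<inter> dom f = ?M \<inter> dom f"
    using assms(1,2) unfolding N_def by (simp add: closed_nbhd_spine) blast
  moreover have "{u \<in> N \<inter> dom f. f u = f (Inl v)} = ?M \<inter> {u. f u = f (Inl v)}"
    using assms(3) \<open>N \<inter> dom f = ?M \<inter> dom f\<close> by (auto simp del: insert_iff)
  ultimately show ?thesis
    using assms(3) unfolding Let_def by (simp only: card_5_Int[OF distinct]) (simp add: domIff)
qed

section \<open>Upper bound on the number of colors\<close>

text \<open>The blocks \<open>{v..v + 2}\<close> for \<open>v\<close> in \<open>X\<close> are
  disjoint and lie in \<open>{a..b + 2}\<close>.\<close>

lemma card_spaced_le:
  fixes X :: "nat set"
  assumes "X \<subseteq> {a..b}" "\<And>v. v \<in> X \<Longrightarrow> Suc v \<notin> X \<and> Suc (Suc v) \<notin> X"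
  shows "3 * card X \<le> b + 3 - a"
proof -
  have fin: "finite X"
    using assms(1) finite_subset by blast
  have less: "v + 2 < w" if "v \<in> X" "w \<in> X" "v < w" for v w
  proof -
    have "w \<noteq> Suc v" "w \<noteq> Suc (Suc v)"
      using assms(2)[OF that(1)] that(2) by auto
    then show ?thesis
      using that(3) by linarith
  qed
  have "3 * card X = card (\<Union>v\<in>X. {v..v + 2})"
  proof (subst card_UN_disjoint)
    show "\<forall>v\<in>X. \<forall>w\<in>X. v \<noteq> w \<longrightarrow> {v..v + 2} \<inter> {w..w + 2} = {}"
    proof (intro ballI impI)
      fix v w assume "v \<in> X" "w \<in> X" "v \<noteq> w"
      then have "v + 2 < w \<or> w + 2 < v"
        using less by (metis nat_neq_iff)
      then show "{v..v + 2} \<inter> {w..w + 2} = {}"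
        by auto
    qed
  qed (use fin in auto)
  also have "\<dots> \<le> card {a..b + 2}"
    using assms(1) by (intro card_mono) fastforce+
  finally show ?thesis
    by simp
qed

text \<open>
  Taking the predecessor for \<open>s\<close> counts first spine vertices, and the successor counts last ones.
\<close>

lemma card_colors_le:
  fixes f :: "nat + nat \<times> nat \<rightharpoonup> nat"
  assumes dom: "dom f \<subseteq> pverts (caterpillar m)" and ran: "ran f = {1..l}"
    and exits: "\<And>X. X \<subseteq> {1..m} \<Longrightarrow> X \<noteq> {} \<Longrightarrow> \<exists>v \<in> X. s v \<notin> X"
  shows "l \<le> (\<Sum>v = 1..m.
      (\<Sum>x\<in>{1, 2}. of_bool (f (Inr (v, x)) \<noteq> None \<and> f (Inr (v, x)) \<noteq> f (Inl v)))
      + of_bool (f (Inl v) \<noteq> None \<and> f (Inl (s v)) \<noteq> f (Inl v)))"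
proof -
  define A where "A = {(v, x) \<in> {1..m} \<times> {1, 2}. f (Inr (v, x)) \<noteq> None \<and> f (Inr (v, x)) \<noteq> f (Inl v)}"
  define B where "B = {v \<in> {1..m}. f (Inl v) \<noteq> None \<and> f (Inl (s v)) \<noteq> f (Inl v)}"
  have fin: "finite A" "finite B"
    by (auto simp: A_def B_def intro: finite_subset[of _ "{1..m} \<times> {1, 2}"])
  have "{1..l} \<subseteq> (\<lambda>u. the (f u)) ` (Inr ` A \<union> Inl ` B)"
  proof
    fix c assume "c \<in> {1..l}"
    then obtain u where u: "f u = Some c"
      using ran by (auto simp: ran_def set_eq_iff)
    define X where "X = {v. f (Inl v) = Some c}"
    have X: "X \<subseteq> {1..m}"
      using dom by (force simp: X_def pverts_caterpillar)
    show "c \<in> (\<lambda>u. the (f u)) ` (Inr ` A \<union> Inl ` B)"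
    proof (cases "X = {}")
      \<comment> \<open>With \<open>c\<close> absent from the spine, a leaf of color
        \<open>c\<close> differs from its spine vertex, colored or not.\<close>
      case True
      then obtain v x where "u = Inr (v, x)"
        using u by (cases u) (auto simp: X_def)
      moreover have "(v, x) \<in> {1..m} \<times> {1, 2}"
        using u dom \<open>u = Inr (v, x)\<close> by (force simp: pverts_caterpillar)
      ultimately have "u \<in> Inr ` A"
        using u True by (auto simp: A_def X_def)
      with u show ?thesis by force
    next
      case False
      then obtain v where "v \<in> X" "s v \<notin> X"
        using exits[OF X] by blast
      then have "v \<in> B" "f (Inl v) = Some c"
        using X by (auto simp: B_def X_def)
      then show ?thesis by force
    qed
  qed
  then have "l \<le> card (Inr ` A \<union> Inl ` B)"
    by (metis card_atLeastAtMost diff_Suc_1 fin finite_UnI finite_imageI surj_card_le)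
  also have "\<dots> = card A + card B"
    using fin by (subst card_Un_disjoint) (auto simp: card_image)
  also have "card A = (\<Sum>v = 1..m. \<Sum>x\<in>{1, 2}.
      of_bool (f (Inr (v, x)) \<noteq> None \<and> f (Inr (v, x)) \<noteq> f (Inl v)))"
  proof -
    have "A = ({1..m} \<times> {1, 2}) \<inter> {p. f (Inr p) \<noteq> None \<and> f (Inr p) \<noteq> f (Inl (fst p))}"
      by (auto simp: A_def)
    then have "card A = (\<Sum>p\<in>{1..m} \<times> {1, 2}. of_bool (f (Inr p) \<noteq> None \<and> f (Inr p) \<noteq> f (Inl (fst p))))"
      by simp
    then show ?thesis
      by (simp only: sum.cartesian_product) (simp add: case_prod_beta)
  qed
  also have "card B = (\<Sum>v = 1..m. of_bool (f (Inl v) \<noteq> None \<and> f (Inl (s v)) \<noteq> f (Inl v)))"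
    by (simp add: B_def Int_def)
  finally show ?thesis
    by (simp only: sum.distrib)
qed

text \<open>
  Here \<open>c\<close> is the color of a spine vertex, \<open>a\<close> and \<open>b\<close> those of its spine neighbors, and \<open>x\<close> and
  \<open>y\<close> those of its leaves.
\<close>

lemma spine_contribution_le:
  fixes a b c x y :: "'c option"
  assumes "c \<noteq> None \<Longrightarrow>
    1 + of_bool (a \<noteq> None) + of_bool (b \<noteq> None) + of_bool (x \<noteq> None) + of_bool (y \<noteq> None)
    \<le> 2 * (1 + of_bool (a = c) + of_bool (b = c) + of_bool (x = c) + of_bool (y = c) :: nat)"
  shows "2 * (of_bool (x \<noteq> None \<and> x \<noteq> c) + of_bool (y \<noteq> None \<and> y \<noteq> c))
      + of_bool (c \<noteq> None \<and> a \<noteq> c) + of_bool (c \<noteq> None \<and> b \<noteq> c)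
    \<le> (4 :: nat) + of_bool (a = None \<and> c \<noteq> None \<and> b \<noteq> None)
      + of_bool (a \<noteq> None \<and> c \<noteq> None \<and> b = None)"
proof (cases "c = None")
  \<comment> \<open>The quorum condition says that the colored neighbors differing from
    \<open>c\<close> outnumber those agreeing with \<open>c\<close> by at most 1. The value 5 thus
    needs two colored leaves differing from \<open>c\<close>, one spine neighbor of color
    \<open>c\<close> and the other uncolored.\<close>
  case False
  then show ?thesis
    using assms[OF False]
    by (cases "a = None"; cases "a = c"; cases "b = None"; cases "b = c";
        cases "x = None"; cases "x = c"; cases "y = None"; cases "y = c") simp_all
qed simp

lemma sub_quorum_coloring_caterpillar_le:
  assumes "m \<ge> 1" "sub_quorum_coloring (caterpillar m) l f"
  shows "l \<le> 2 * m + (m + 1) div 3"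
proof -
  have dom: "dom f \<subseteq> pverts (caterpillar m)" and ran: "ran f = {1..l}"
    using assms(2) by (auto simp: sub_quorum_coloring_def)
  define g where "g v = f (Inl v)" for v
  define h where "h v x = f (Inr (v, x))" for v x
  define leaves :: "nat \<Rightarrow> nat" where
    "leaves v = (\<Sum>x\<in>{1, 2}. of_bool (h v x \<noteq> None \<and> h v x \<noteq> g v))" for v
  have leaves_eq: "leaves v =
      of_bool (h v 1 \<noteq> None \<and> h v 1 \<noteq> g v) + of_bool (h v 2 \<noteq> None \<and> h v 2 \<noteq> g v)" for v
    by (simp add: leaves_def del: sum_of_bool_eq)
  define starts ends :: "nat \<Rightarrow> nat" where
    "starts v = of_bool (g v \<noteq> None \<and> g (v - 1) \<noteq> g v)" and
    "ends v = of_bool (g v \<noteq> None \<and> g (Suc v) \<noteq> g v)" for v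
  \<comment> \<open>The left and right ends of the maximal runs of at least two colored spine
    vertices.\<close>
  define L where "L = {v \<in> {1..m}. g (v - 1) = None \<and> g v \<noteq> None \<and> g (Suc v) \<noteq> None}"
  define R where "R = {v \<in> {1..m}. g (v - 1) \<noteq> None \<and> g v \<noteq> None \<and> g (Suc v) = None}"
  have spine: "v \<in> {1..m}" if "g v \<noteq> None" for v
    using that dom by (force simp: pverts_caterpillar g_def)
  have L_le: "3 * card L \<le> m + 1"
  proof -
    have "L \<subseteq> {1..m - 1}"
      using spine by (fastforce simp: L_def)
    \<comment> \<open>If \<open>v\<close> is in \<open>L\<close>, then \<open>v\<close> and
      \<open>Suc v\<close> are colored, so neither of the next two vertices has an uncolored
      predecessor.\<close>
    then have "3 * card L \<le> m - 1 + 3 - 1"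
      by (rule card_spaced_le) (auto simp: L_def)
    with assms(1) show ?thesis by simp
  qed
  have R_le: "3 * card R \<le> m + 1"
  proof -
    have "v \<noteq> 1" if "v \<in> R" for v
      using that spine[of 0] by (auto simp: R_def)
    then have "R \<subseteq> {2..m}"
      by (fastforce simp: R_def)
    \<comment> \<open>If \<open>v\<close> is in \<open>R\<close>, then \<open>Suc v\<close> is
      uncolored, which bars both it and its successor from \<open>R\<close>.\<close>
    then have "3 * card R \<le> m + 3 - 2"
      by (rule card_spaced_le) (auto simp: R_def)
    with assms(1) show ?thesis by simp
  qed
  have le: "2 * leaves v + starts v + ends v \<le> 4 + of_bool (v \<in> L) + of_bool (v \<in> R)"
    if v: "v \<in> {1..m}" for v
  proof -
    have "1 + of_bool (g (v - 1) \<noteq> None) + of_bool (g (Suc v) \<noteq> None)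
        + of_bool (h v 1 \<noteq> None) + of_bool (h v 2 \<noteq> None)
      \<le> 2 * (1 + of_bool (g (v - 1) = g v) + of_bool (g (Suc v) = g v)
        + of_bool (h v 1 = g v) + of_bool (h v 2 = g v) :: nat)" if "g v \<noteq> None"
      using that quorum_spine_iff[OF dom v] assms(2)
      by (auto simp: sub_quorum_coloring_def Let_def g_def h_def)
    from spine_contribution_le[OF this] show ?thesis
      using v unfolding leaves_eq by (simp add: starts_def ends_def L_def R_def)
  qed
  have "l \<le> (\<Sum>v = 1..m. leaves v + starts v)"
    unfolding leaves_def starts_def g_def h_def
  proof (rule card_colors_le[OF dom ran])
    fix X assume X: "X \<subseteq> {1..m}" "X \<noteq> {}"
    then have "Min X \<in> X" "finite X"
      using finite_subset[of X "{1..m}"] by auto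
    \<comment> \<open>Holds because 0 is not in \<open>X\<close>.\<close>
    moreover have "Min X - 1 < Min X"
      using X \<open>Min X \<in> X\<close> by auto
    ultimately show "\<exists>v\<in>X. v - 1 \<notin> X"
      by (metis Min_le not_le)
  qed
  moreover have "l \<le> (\<Sum>v = 1..m. leaves v + ends v)"
    unfolding leaves_def ends_def g_def h_def
    by (rule card_colors_le[OF dom ran])
      (metis Max_ge Max_in Suc_n_not_le_n finite_atLeastAtMost finite_subset)
  ultimately have "2 * l \<le> (\<Sum>v = 1..m. 2 * leaves v + starts v + ends v)"
    by (simp add: sum.distrib sum_distrib_left[symmetric])
  also have "\<dots> \<le> (\<Sum>v = 1..m. 4 + of_bool (v \<in> L) + of_bool (v \<in> R))"
    by (rule sum_mono) (rule le)
  also have "\<dots> = 4 * m + card L + card R"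
  proof -
    have "{1..m} \<inter> L = L" "{1..m} \<inter> R = R"
      by (auto simp: L_def R_def)
    then show ?thesis
      by (simp add: sum.distrib)
  qed
  \<comment> \<open>Each of \<open>card L\<close> and \<open>card R\<close> is an integer, hence at
    most \<open>(m + 1) div 3\<close>.\<close>
  finally show ?thesis
    using L_le R_le by linarith
qed

section \<open>A coloring that attains the bound\<close>

text \<open>The quotient \<open>v div 3\<close> indexes the pairs of spine vertices. The condition
  on \<open>m\<close> requires the whole pair to lie on the path, so a last vertex
  \<open>m = 3k + 1\<close> stays uncolored.\<close>

definition optimal_coloring :: "nat \<Rightarrow> nat + nat \<times> nat \<rightharpoonup> nat" where
  "optimal_coloring m u = (case u of
      Inl v \<Rightarrow> if v mod 3 \<noteq> 0 \<and> 3 * (v div 3) + 2 \<le> m then Some (2 * m + v div 3 + 1) else None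
    | Inr (v, x) \<Rightarrow> if v \<in> {1..m} \<and> x \<in> {1, 2} then Some (2 * (v - 1) + x) else None)"

lemma ran_optimal_coloring: "ran (optimal_coloring m) = {1..2 * m + (m + 1) div 3}"
proof
  show "ran (optimal_coloring m) \<subseteq> {1..2 * m + (m + 1) div 3}"
  proof
    fix c assume "c \<in> ran (optimal_coloring m)"
    then obtain u where "optimal_coloring m u = Some c"
      by (auto simp: ran_def)
    then show "c \<in> {1..2 * m + (m + 1) div 3}"
      by (cases u) (auto simp: optimal_coloring_def split: if_splits)
  qed
  show "{1..2 * m + (m + 1) div 3} \<subseteq> ran (optimal_coloring m)"
  proof
    fix c assume c: "c \<in> {1..2 * m + (m + 1) div 3}"
    show "c \<in> ran (optimal_coloring m)"
    proof (cases "c \<le> 2 * m")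
      case True
      define v x where "v = (c - 1) div 2 + 1" and "x = (c - 1) mod 2 + 1"
      have "v \<in> {1..m}" "x \<in> {1, 2}" "c = 2 * (v - 1) + x"
        using True c by (auto simp: v_def x_def)
      then have "optimal_coloring m (Inr (v, x)) = Some c"
        by (simp add: optimal_coloring_def)
      then show ?thesis
        by (rule ranI)
    next
      case False
      define k where "k = c - 2 * m - 1"
      \<comment> \<open>\<open>3 * k + 2 \<le> m\<close> is equivalent to
        \<open>k < (m + 1) div 3\<close>, which gives the number of pairs.\<close>
      have "c = 2 * m + k + 1" "3 * k + 2 \<le> m"
        using False c by (auto simp: k_def)
      moreover have "(3 * k + 1) div 3 = k" "(3 * k + 1) mod 3 = 1"
        by presburger+
      ultimately have "optimal_coloring m (Inl (3 * k + 1)) = Some c"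
        by (simp add: optimal_coloring_def)
      then show ?thesis
        by (rule ranI)
    qed
  qed
qed

text \<open>A colored spine vertex sees four colored vertices: itself and its partner, which share a
  color, and two leaves. A leaf sees at most two, one being itself.\<close>

lemma sub_quorum_coloring_optimal_coloring:
  "sub_quorum_coloring (caterpillar m) (2 * m + (m + 1) div 3) (optimal_coloring m)"
proof -
  let ?f = "optimal_coloring m"
  have spine: "v \<in> {1..m}" if "v mod 3 \<noteq> 0" "3 * (v div 3) + 2 \<le> m" for v
  proof -
    have "v \<noteq> 0"
      using that(1) by (metis mod_0)
    moreover have "v \<le> 3 * (v div 3) + 2"
      by presburger
    ultimately show ?thesis
      using that(2) by simp
  qed
  have dom: "dom ?f \<subseteq> pverts (caterpillar m)"
  proof
    fix u assume u: "u \<in> dom ?f"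
    show "u \<in> pverts (caterpillar m)"
    proof (cases u)
      case (Inl v)
      then show ?thesis
        using u spine[of v] unfolding pverts_caterpillar
        by (simp add: domIff optimal_coloring_def split: if_splits)
    next
      case (Inr p)
      then obtain v x where "u = Inr (v, x)"
        by (cases p) simp
      then have "v \<in> {1..m} \<and> x \<in> {1, 2}"
        using u by (simp add: domIff optimal_coloring_def split: if_splits)
      then show ?thesis
        using \<open>u = Inr (v, x)\<close> unfolding pverts_caterpillar by blast
    qed
  qed
  have "real (card {u \<in> closed_nbhd (caterpillar m) w \<inter> dom ?f. ?f u = ?f w})
      \<ge> real (card (closed_nbhd (caterpillar m) w \<inter> dom ?f)) / 2" if w: "w \<in> dom ?f" for w
  proof (cases w)
    case (Inl v)
    have v: "v mod 3 \<noteq> 0" "3 * (v div 3) + 2 \<le> m"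
      using w Inl by (auto simp: optimal_coloring_def split: if_splits)
    have v0: "v \<in> {1..m}"
      using spine[OF v] .
    define k where "k = v div 3"
    have k: "3 * k + 2 \<le> m"
      using v(2) by (simp add: k_def)
    have "v = 3 * k + 1 \<or> v = 3 * k + 2"
      unfolding k_def using v(1) by presburger
    \<comment> \<open>One spine neighbor is the partner; the other has index divisible by 3
      (possibly 0) and is uncolored.\<close>
    then have "?f (Inl (v - 1)) = None \<and> ?f (Inl (Suc v)) = ?f (Inl v) \<or>
        ?f (Inl (v - 1)) = ?f (Inl v) \<and> ?f (Inl (Suc v)) = None"
    proof
      assume v: "v = 3 * k + 1"
      have "Suc v mod 3 = 2" "Suc v div 3 = k" "v mod 3 = 1" "v div 3 = k"
        unfolding v by presburger+
      with k v show ?thesis by (simp add: optimal_coloring_def)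
    next
      assume v: "v = 3 * k + 2"
      then have "v - 1 = 3 * k + 1"
        by simp
      then have "(v - 1) mod 3 = 1" "(v - 1) div 3 = k"
        by presburger+
      moreover have "Suc v mod 3 = 0" "v mod 3 = 2" "v div 3 = k"
        unfolding v by presburger+
      ultimately show ?thesis using k by (simp add: optimal_coloring_def)
    qed
    moreover have "?f (Inl v) \<noteq> None"
      using w Inl by auto
    ultimately show ?thesis
      unfolding Inl quorum_spine_iff[OF dom v0 \<open>?f (Inl v) \<noteq> None\<close>]
      by (auto simp: Let_def)
  next
    case (Inr p)
    then obtain v x where p: "w = Inr (v, x)" "v \<in> {1..m}" "x \<in> {1, 2}"
      using subsetD[OF dom w] by (auto simp: pverts_caterpillar)
    let ?N = "closed_nbhd (caterpillar m) w"
    have N: "?N = {w, Inl v}"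
      unfolding p(1) by (rule closed_nbhd_leaf[OF p(2,3)])
    have "card (?N \<inter> dom ?f) \<le> card {w, Inl v}"
      unfolding N by (rule card_mono) auto
    also have "\<dots> \<le> 2"
      using p(1) by simp
    finally have "card (?N \<inter> dom ?f) \<le> 2" .
    moreover have "card {w} \<le> card {u \<in> ?N \<inter> dom ?f. ?f u = ?f w}"
      using w by (intro card_mono) (auto simp: N)
    ultimately show ?thesis
      by simp
  qed
  then show ?thesis
    using dom unfolding sub_quorum_coloring_def ran_optimal_coloring by blast
qed

section \<open>The closed form and the maximum\<close>

text \<open>For \<open>m = 3 * q + r\<close> the ceiling is \<open>2 * q + r\<close> when
  \<open>r\<close> is 0, 1 or 2, so halving gains a unit over \<open>q\<close> only for
  \<open>r = 2\<close>.\<close>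

lemma floor_half_ceiling: "\<lfloor>(1 / 2) * real_of_int \<lceil>2 * real m / 3\<rceil>\<rfloor> = int ((m + 1) div 3)"
proof -
  define q where "q = m div 3"
  have "m = 3 * q \<or> m = 3 * q + 1 \<or> m = 3 * q + 2"
    unfolding q_def by presburger
  then show ?thesis
  proof (elim disjE)
    assume m: "m = 3 * q"
    have "\<lceil>2 * real m / 3\<rceil> = 2 * int q"
      by (simp add: m ceiling_eq_iff)
    then show ?thesis
      by (simp add: m floor_eq_iff)
  next
    assume m: "m = 3 * q + 1"
    have "\<lceil>2 * real m / 3\<rceil> = 2 * int q + 1"
      by (simp add: m ceiling_eq_iff field_simps)
    moreover have "(m + 1) div 3 = q"
      unfolding m by presburger
    ultimately show ?thesis
      by (simp add: floor_eq_iff)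
  next
    assume m: "m = 3 * q + 2"
    have "\<lceil>2 * real m / 3\<rceil> = 2 * int q + 2"
      by (simp add: m ceiling_eq_iff field_simps)
    moreover have "(m + 1) div 3 = q + 1"
      unfolding m by presburger
    ultimately show ?thesis
      by (simp add: floor_eq_iff)
  qed
qed

theorem theorem17:
  fixes m :: nat
  assumes "m \<ge> 1"
  shows "int (\<psi>\<^sub>s\<^sub>q (corona (path_graph m) (edgeless_graph 2)))
           = 2 * int m + \<lfloor>(1 / 2) * real_of_int \<lceil>2 * real m / 3\<rceil>\<rfloor>"
proof -
  have "finite (pverts (caterpillar m))"
    by (simp add: pverts_caterpillar)
  then have "\<psi>\<^sub>s\<^sub>q (caterpillar m) = 2 * m + (m + 1) div 3"
    unfolding sub_quorum_coloring_number_def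
  proof (rule Max_eqI[OF finite_sub_quorum_coloring_sizes])
    show "2 * m + (m + 1) div 3 \<in> {l. \<exists>f. sub_quorum_coloring (caterpillar m) l f}"
      using sub_quorum_coloring_optimal_coloring by blast
  qed (use sub_quorum_coloring_caterpillar_le[OF assms] in auto)
  then show ?thesis
    by (simp only: floor_half_ceiling)
qed

end
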